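(* Let $a<b$ be real numbers and let $r,s$ be positive measurable functions on the interval $(a,b)$ such that $\int_a^b \frac{dt}{s(t)}<\infty$ and such that $R(x,b)=\int_x^b r(t)\,dt$ is a positive, bounded and non-increasing function of $x$ on $(a,b)$. Then for all measurable functions $f\ge 0$ on $(a,b)$ such that all integrals below exist and are finite, $$\int_a^b r(x)\left(\int_a^x f(t)\,dt\right)^2dx\le\left(\int_a^b\frac{dx}{s(x)}\right)\int_a^b R(x,b)\,s(x)\,(f(x))^2\,dx.$$
   Context: Standing assumption: all functions are measurable and all the integrals appearing in the inequality (including $\int_a^x f$ for $x\in(a,b)$) exist and are finite. *)

theory Defs
  imports "HOL-Analysis.Analysis"
begin

(* The Bochner integral is 0 for a function that is not integrable, so statements about
   tail_integral r x b must assume integrability of r on the interval separately. *)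
definition tail_integral :: "(real \<Rightarrow> real) \<Rightarrow> real \<Rightarrow> real \<Rightarrow> real" where
  "tail_integral r x b = (LINT t:{x<..<b}|lebesgue. r t)"

end

theory Submission
  imports Defs
begin

text \<open>By the Cauchy-Schwarz inequality with weight \<open>s\<close>, the square of the integral of \<open>f\<close> over
  \<open>(a, x)\<close> is at most the integral of \<open>1/s\<close> over \<open>(a, b)\<close> times the integral of \<open>s f\<^sup>2\<close> over \<open>(a, x)\<close>.
  Integrate this against \<open>r\<close> and exchange the order of integration: the point \<open>t\<close> collects the
  weight \<open>R(t, b)\<close>. Working with nonnegative integrals makes Tonelli's theorem applicable
  without any integrability of \<open>s f\<^sup>2\<close>.\<close>

lemma weighted_Cauchy_Schwarz_nn_integral:
  fixes s f :: "'a \<Rightarrow> real"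
  assumes [measurable]: "s \<in> borel_measurable M" "f \<in> borel_measurable M" "A \<in> sets M"
    and s_pos: "\<And>x. x \<in> space M \<Longrightarrow> 0 < s x"
    and f_nonneg: "\<And>x. x \<in> space M \<Longrightarrow> 0 \<le> f x"
  shows "(\<integral>\<^sup>+x\<in>A. f x \<partial>M)\<^sup>2 \<le> (\<integral>\<^sup>+x. 1 / s x \<partial>M) * (\<integral>\<^sup>+x\<in>A. s x * (f x)\<^sup>2 \<partial>M)"
proof -
  \<comment> \<open>The factors are \<open>1 / sqrt s\<close> and \<open>sqrt s * f\<close>. The
    indicator of \<open>A\<close> goes to the second factor alone, so the first one yields the
    integral of \<open>1 / s\<close> over the whole space, a constant that does not depend on
    \<open>A\<close>.\<close>
  let ?u = "\<lambda>x. ennreal (sqrt (1 / s x))"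
  let ?v = "\<lambda>x. ennreal (sqrt (s x) * f x) * indicator A x"
  have uv: "?u x * ?v x = ennreal (f x) * indicator A x" if "x \<in> space M" for x
    using s_pos[OF that] f_nonneg[OF that]
    by (auto simp: ennreal_mult'[symmetric] real_sqrt_divide split: split_indicator)
  have uu: "(?u x)\<^sup>2 = ennreal (1 / s x)" if "x \<in> space M" for x
    using s_pos[OF that] by (simp add: ennreal_power)
  have vv: "(?v x)\<^sup>2 = ennreal (s x * (f x)\<^sup>2) * indicator A x" if "x \<in> space M" for x
    using s_pos[OF that] f_nonneg[OF that]
    by (auto simp: ennreal_power power_mult_distrib split: split_indicator)
  have "(\<integral>\<^sup>+x. ?u x * ?v x \<partial>M)\<^sup>2 \<le> (\<integral>\<^sup>+x. (?u x)\<^sup>2 \<partial>M) * (\<integral>\<^sup>+x. (?v x)\<^sup>2 \<partial>M)"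
    by (rule Cauchy_Schwarz_nn_integral) measurable
  then show ?thesis
    by (simp add: uv uu vv cong: nn_integral_cong)
qed

text \<open>The interval is hidden in the space of \<open>M\<close>: inside \<open>(a, b)\<close>
  the rays \<open>{..<x}\<close> and \<open>{t<..}\<close> become \<open>(a, x)\<close> and
  \<open>(t, b)\<close>. Measurability of the identity makes the triangle \<open>t < x\<close>
  measurable in the product, which Tonelli's theorem requires; it also holds when \<open>M\<close>
  carries the Lebesgue rather than the Borel sets.\<close>

lemma weighted_Hardy_nn_integral:
  fixes M :: "real measure" and r s f :: "real \<Rightarrow> real"
  assumes "sigma_finite_measure M"
    and id [measurable]: "(\<lambda>x. x) \<in> borel_measurable M"
    and [measurable]: "r \<in> borel_measurable M" "s \<in> borel_measurable M" "f \<in> borel_measurable M"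
    and s_pos: "\<And>x. x \<in> space M \<Longrightarrow> 0 < s x"
    and f_nonneg: "\<And>x. x \<in> space M \<Longrightarrow> 0 \<le> f x"
  shows "(\<integral>\<^sup>+x. r x * (\<integral>\<^sup>+t\<in>{..<x}. f t \<partial>M)\<^sup>2 \<partial>M)
    \<le> (\<integral>\<^sup>+x. 1 / s x \<partial>M) * (\<integral>\<^sup>+t. (\<integral>\<^sup>+x\<in>{t<..}. r x \<partial>M) * (s t * (f t)\<^sup>2) \<partial>M)"
proof -
  interpret sf: sigma_finite_measure M by fact
  interpret pair_sigma_finite M M ..
  let ?C = "\<integral>\<^sup>+x. ennreal (1 / s x) \<partial>M"
  let ?g = "\<lambda>t. ennreal (s t * (f t)\<^sup>2)"
  have CS: "(\<integral>\<^sup>+t\<in>{..<x}. f t \<partial>M)\<^sup>2 \<le> ?C * (\<integral>\<^sup>+t\<in>{..<x}. ?g t \<partial>M)" for x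
  proof -
    \<comment> \<open>The ray itself may leave the space of \<open>M\<close>, so it is cut down to
      the space, which changes no integral.\<close>
    have A: "{..<x} \<inter> space M \<in> sets M"
      using measurable_sets[OF id, of "{..<x}"] by simp
    have "(\<integral>\<^sup>+t\<in>{..<x}. h t \<partial>M) = (\<integral>\<^sup>+t\<in>{..<x} \<inter> space M. h t \<partial>M)" for h
      by (intro nn_integral_cong) (auto split: split_indicator)
    then show ?thesis
      using weighted_Cauchy_Schwarz_nn_integral[OF _ _ A s_pos f_nonneg] by simp
  qed
  have [measurable]: "Measurable.pred (M \<Otimes>\<^sub>M M) (\<lambda>z. snd z < fst z)"
    by (intro borel_measurable_pred_less measurable_compose[OF measurable_fst id]
        measurable_compose[OF measurable_snd id])
  have meas: "(\<lambda>(x, t). ennreal (r x) * (?g t * indicator {..<x} t))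
      \<in> borel_measurable (M \<Otimes>\<^sub>M M)"
    \<comment> \<open>The set \<open>{..<x}\<close> varies with \<open>x\<close>; unfolding turns
      its indicator into the fixed condition \<open>snd z < fst z\<close> on pairs.\<close>
    unfolding indicator_def lessThan_iff split_beta' by measurable
  have "(\<integral>\<^sup>+x. r x * (\<integral>\<^sup>+t\<in>{..<x}. f t \<partial>M)\<^sup>2 \<partial>M)
      \<le> (\<integral>\<^sup>+x. ?C * (ennreal (r x) * (\<integral>\<^sup>+t\<in>{..<x}. ?g t \<partial>M)) \<partial>M)"
    unfolding mult.left_commute[of ?C]
    by (intro nn_integral_mono mult_left_mono CS) simp
  also have "\<dots> = (\<integral>\<^sup>+x. ?C * (\<integral>\<^sup>+t. ennreal (r x) * (?g t * indicator {..<x} t) \<partial>M) \<partial>M)"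
    by (simp add: nn_integral_cmult)
  also have "\<dots> = ?C * (\<integral>\<^sup>+x. \<integral>\<^sup>+t. ennreal (r x) * (?g t * indicator {..<x} t) \<partial>M \<partial>M)"
    using sf.borel_measurable_nn_integral[OF meas] by (rule nn_integral_cmult)
  also have "\<dots> = ?C * (\<integral>\<^sup>+t. \<integral>\<^sup>+x. ennreal (r x) * (?g t * indicator {..<x} t) \<partial>M \<partial>M)"
    by (rule arg_cong[OF Fubini'[OF meas, symmetric]])
  \<comment> \<open>For fixed \<open>t\<close> the condition \<open>t < x\<close> is read as one on
    \<open>x\<close>; then \<open>?g t\<close> is constant in the inner integral and the tail of
    \<open>r\<close> remains.\<close>
  also have "\<dots> = ?C * (\<integral>\<^sup>+t. \<integral>\<^sup>+x. (ennreal (r x) * indicator {t<..} x) * ?g t \<partial>M \<partial>M)"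
    by (intro arg_cong[where f = "times ?C"] nn_integral_cong)
      (auto simp: ac_simps split: split_indicator)
  also have "\<dots> = ?C * (\<integral>\<^sup>+t. (\<integral>\<^sup>+x\<in>{t<..}. r x \<partial>M) * ?g t \<partial>M)"
    by (simp add: nn_integral_multc)
  finally show ?thesis .
qed

text \<open>Passes between the Bochner integrals of the theorem and nonnegative integrals.
  Integrability matters: without it the left side defaults to 0 while the right side may be
  infinite. \<open>A\<close> is kept apart from \<open>B\<close> so that \<open>A\<close> can be a
  ray.\<close>

lemma ennreal_set_integral_eq_nn_integral_lebesgue_on:
  fixes g :: "'a::euclidean_space \<Rightarrow> real"
  assumes "S \<in> sets lebesgue" "A \<inter> S = B" "set_integrable lebesgue B g"
    and "\<And>x. x \<in> B \<Longrightarrow> 0 \<le> g x"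
  shows "ennreal (LINT x:B|lebesgue. g x) = (\<integral>\<^sup>+x\<in>A. g x \<partial>lebesgue_on S)"
proof -
  have "ennreal (LINT x:B|lebesgue. g x) = (\<integral>\<^sup>+x. ennreal (indicator B x *\<^sub>R g x) \<partial>lebesgue)"
    unfolding set_lebesgue_integral_def using assms(3,4)
    by (subst nn_integral_eq_integral) (auto simp: set_integrable_def split: split_indicator)
  also have "\<dots> = (\<integral>\<^sup>+x. ennreal (g x) * indicator A x * indicator S x \<partial>lebesgue)"
    using assms(2) by (intro nn_integral_cong) (auto split: split_indicator)
  also have "\<dots> = (\<integral>\<^sup>+x\<in>A. g x \<partial>lebesgue_on S)"
    using assms(1) by (simp add: nn_integral_restrict_space)
  finally show ?thesis .
qed

theorem theorem2p9:
  fixes a b :: real and r s f :: "real \<Rightarrow> real"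
  assumes ab: "a < b"
    and r_meas: "r \<in> borel_measurable (lebesgue_on {a<..<b})"
    and s_meas: "s \<in> borel_measurable (lebesgue_on {a<..<b})"
    and r_pos: "\<And>x. x \<in> {a<..<b} \<Longrightarrow> 0 < r x"
    and s_pos: "\<And>x. x \<in> {a<..<b} \<Longrightarrow> 0 < s x"
    and inv_s_int: "set_integrable lebesgue {a<..<b} (\<lambda>t. 1 / s t)"
    and r_int: "\<And>x. x \<in> {a<..<b} \<Longrightarrow> set_integrable lebesgue {x<..<b} r"
    and R_pos: "\<And>x. x \<in> {a<..<b} \<Longrightarrow> 0 < tail_integral r x b"
    and R_bounded: "bounded ((\<lambda>x. tail_integral r x b) ` {a<..<b})"
    and R_antimono: "antimono_on {a<..<b} (\<lambda>x. tail_integral r x b)"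
    and f_meas: "f \<in> borel_measurable (lebesgue_on {a<..<b})"
    and f_nonneg: "\<And>x. x \<in> {a<..<b} \<Longrightarrow> 0 \<le> f x"
    and f_int: "\<And>x. x \<in> {a<..<b} \<Longrightarrow> set_integrable lebesgue {a<..<x} f"
    and lhs_int: "set_integrable lebesgue {a<..<b}
                    (\<lambda>x. r x * (LINT t:{a<..<x}|lebesgue. f t)\<^sup>2)"
    and rhs_int: "set_integrable lebesgue {a<..<b}
                    (\<lambda>x. tail_integral r x b * s x * (f x)\<^sup>2)"
  shows "(LINT x:{a<..<b}|lebesgue. r x * (LINT t:{a<..<x}|lebesgue. f t)\<^sup>2)
           \<le> (LINT x:{a<..<b}|lebesgue. 1 / s x)
              * (LINT x:{a<..<b}|lebesgue. tail_integral r x b * s x * (f x)\<^sup>2)"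
proof -
  \<comment> \<open>Measurability and signs are known on \<open>(a, b)\<close> only, hence the
    restricted measure. It is finite because the interval is bounded, and so sigma-finite.\<close>
  define M where "M = lebesgue_on {a<..<b}"
  define F where "F x = (LINT t:{a<..<x}|lebesgue. f t)" for x
  let ?R = "\<lambda>x. tail_integral r x b"
  have space_M: "space M = {a<..<b}"
    by (simp add: M_def space_restrict_space)
  have "sigma_finite_measure M"
    unfolding M_def
    by (intro finite_measure.axioms(1) finite_measure_lebesgue_on) simp
  moreover have "(\<lambda>x. x) \<in> borel_measurable M"
    unfolding M_def by (intro measurable_restrict_space1 measurable_completion) simp
  ultimately have main: "(\<integral>\<^sup>+x. r x * (\<integral>\<^sup>+t\<in>{..<x}. f t \<partial>M)\<^sup>2 \<partial>M)
    \<le> (\<integral>\<^sup>+x. 1 / s x \<partial>M) * (\<integral>\<^sup>+t. (\<integral>\<^sup>+x\<in>{t<..}. r x \<partial>M) * (s t * (f t)\<^sup>2) \<partial>M)"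
    using r_meas s_meas f_meas s_pos f_nonneg
    by (intro weighted_Hardy_nn_integral) (auto simp: space_M simp flip: M_def)
  have conv: "ennreal (LINT x:{a<..<b}|lebesgue. g x) = (\<integral>\<^sup>+x. g x \<partial>M)"
    if "set_integrable lebesgue {a<..<b} g" "\<And>x. x \<in> {a<..<b} \<Longrightarrow> 0 \<le> g x" for g
    using ennreal_set_integral_eq_nn_integral_lebesgue_on[of "{a<..<b}" UNIV, OF _ _ that]
    by (simp add: M_def)
  have F_eq: "(\<integral>\<^sup>+t\<in>{..<x}. f t \<partial>M) = ennreal (F x)" and F_nonneg: "0 \<le> F x"
    if "x \<in> {a<..<b}" for x
  proof -
    have "{..<x} \<inter> {a<..<b} = {a<..<x}" using that by auto
    then show "(\<integral>\<^sup>+t\<in>{..<x}. f t \<partial>M) = ennreal (F x)"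
      unfolding M_def F_def using that f_nonneg f_int
      by (intro ennreal_set_integral_eq_nn_integral_lebesgue_on[symmetric]) auto
    show "0 \<le> F x"
      unfolding F_def set_lebesgue_integral_def using that f_nonneg
      by (intro integral_nonneg_AE) (auto split: split_indicator)
  qed
  have R_eq: "(\<integral>\<^sup>+x\<in>{t<..}. r x \<partial>M) = ennreal (?R t)" if "t \<in> {a<..<b}" for t
  proof -
    have "{t<..} \<inter> {a<..<b} = {t<..<b}" using that by auto
    then show ?thesis
      unfolding M_def tail_integral_def using that r_pos r_int
      by (intro ennreal_set_integral_eq_nn_integral_lebesgue_on[symmetric]) (auto intro: less_imp_le)
  qed
  \<comment> \<open>Each integral in \<open>main\<close> is now replaced by its Bochner counterpart,
    first on the left and then in the two factors on the right.\<close>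
  have "ennreal (LINT x:{a<..<b}|lebesgue. r x * (F x)\<^sup>2) = (\<integral>\<^sup>+x. r x * (F x)\<^sup>2 \<partial>M)"
    using lhs_int r_pos by (intro conv) (auto simp: F_def less_imp_le)
  also have "\<dots> = (\<integral>\<^sup>+x. r x * (\<integral>\<^sup>+t\<in>{..<x}. f t \<partial>M)\<^sup>2 \<partial>M)"
    using r_pos F_nonneg
    by (intro nn_integral_cong) (simp add: space_M F_eq ennreal_mult' ennreal_power less_imp_le)
  also note main
  also have "(\<integral>\<^sup>+t. (\<integral>\<^sup>+x\<in>{t<..}. r x \<partial>M) * (s t * (f t)\<^sup>2) \<partial>M) = (\<integral>\<^sup>+t. ?R t * s t * (f t)\<^sup>2 \<partial>M)"
    using R_pos
    by (intro nn_integral_cong) (simp add: space_M R_eq ennreal_mult'[symmetric] less_imp_le mult.assoc)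
  also have "\<dots> = ennreal (LINT x:{a<..<b}|lebesgue. ?R x * s x * (f x)\<^sup>2)"
    using rhs_int R_pos s_pos by (intro conv[symmetric]) (auto simp: less_imp_le)
  also have "(\<integral>\<^sup>+x. 1 / s x \<partial>M) = ennreal (LINT x:{a<..<b}|lebesgue. 1 / s x)"
    using inv_s_int s_pos by (intro conv[symmetric]) (auto simp: less_imp_le)
  finally have le: "ennreal (LINT x:{a<..<b}|lebesgue. r x * (F x)\<^sup>2)
    \<le> ennreal (LINT x:{a<..<b}|lebesgue. 1 / s x)
      * ennreal (LINT x:{a<..<b}|lebesgue. ?R x * s x * (f x)\<^sup>2)" .
  \<comment> \<open>Since \<open>ennreal\<close> sends negative numbers to 0, returning to the reals
    needs both factors nonnegative: then \<open>ennreal\<close> respects their product and the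
    inequality can be read off in the reals.\<close>
  have "0 \<le> (LINT x:{a<..<b}|lebesgue. 1 / s x)"
    unfolding set_lebesgue_integral_def using s_pos
    by (intro integral_nonneg_AE) (auto simp: less_imp_le split: split_indicator)
  moreover have "0 \<le> (LINT x:{a<..<b}|lebesgue. ?R x * s x * (f x)\<^sup>2)"
    unfolding set_lebesgue_integral_def using R_pos s_pos
    by (intro integral_nonneg_AE) (auto simp: less_imp_le split: split_indicator)
  ultimately show ?thesis
    using le by (simp add: F_def ennreal_mult'[symmetric])
qed

end
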